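(* Let $H,K$ be separable Hilbert spaces, let $T\in GL(H)$ and $U\in GL(K)$. Let $\{\Lambda_i\in L(H,V_i)\}_{i\in I}$ be a $(T,T)$-controlled g-frame for $H$ with bounds $(A,B)$, and let $\{\Gamma_i\in L(K,W_i)\}_{i\in I}$ be a $(U,U)$-controlled g-frame for $K$ with bounds $(C,D)$. Then $\{\Lambda_i\oplus\Gamma_i\in L(H\oplus K,V_i\oplus W_i)\}_{i\in I}$ is a $(T\oplus U,T\oplus U)$-controlled g-frame for $H\oplus K$ with bounds $(\min\{A,C\},\max\{B,D\})$; in particular, for all $(f,g)\in H\oplus K$, $$\min\{A,C\}\,\|(f,g)\|^2\le\sum_{i\in I}\|(\Lambda_i\oplus\Gamma_i)(Tf,Ug)\|^2\le\max\{B,D\}\,\|(f,g)\|^2 .$$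
   Context: $I\subset\mathbb Z$; $V_i,W_i$ ($i\in I$) are Hilbert spaces. $L(X,Y)$ is the set of bounded linear operators $X\to Y$; $GL(X)$ is the set of bounded linear operators on $X$ with bounded inverse. $H\oplus K$ is the Hilbert space of pairs $(f,g)$, $f\in H$, $g\in K$, with inner product $\langle(f,g),(f',g')\rangle=\langle f,f'\rangle_H+\langle g,g'\rangle_K$. For bounded operators $P$ on $H$ and $Q$ on $K$, $(P\oplus Q)(f,g)=(Pf,Qg)$. For a Hilbert space $X$ and $T\in GL(X)$, a family $\{\Lambda_i\in L(X,Y_i)\}_{i\in I}$ is a $(T,T)$-controlled g-frame for $X$ with bounds $(A,B)$, $0<A\le B<\infty$, if it is a g-Bessel sequence (i.e. $\sum_{i\in I}\|\Lambda_if\|^2\le D'\|f\|^2$ for all $f\in X$, for some $D'<\infty$) and $A\|f\|^2\le\sum_{i\in I}\|\Lambda_iTf\|^2\le B\|f\|^2$ for all $f\in X$. *)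

theory Defs
  imports "HOL-Analysis.Analysis" "HOL-Algebra.Module"
begin

section \<open>Scalars\<close>

text \<open>
  Hilbert spaces are taken over the real or the complex numbers. The class below treats both
  cases at once. Its axioms make the squared norm of \<open>x + 1\<close> real, so \<open>x + scalar_conj x\<close> is
  real and every \<open>x\<close> is a root of a real quadratic polynomial; up to isomorphism the only models
  are thus \<open>real\<close> with the identity and \<open>complex\<close> with conjugation.
\<close>

class hilbert_scalar = real_normed_field +
  fixes scalar_conj :: "'a \<Rightarrow> 'a"
  assumes scalar_conj_add: "scalar_conj (x + y) = scalar_conj x + scalar_conj y"
    and scalar_conj_mult: "scalar_conj (x * y) = scalar_conj x * scalar_conj y"
    and mult_scalar_conj: "x * scalar_conj x = (norm x)\<^sup>2 *\<^sub>R 1"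

instantiation real :: hilbert_scalar
begin
definition scalar_conj_real :: "real \<Rightarrow> real" where "scalar_conj_real x = x"
instance
  by standard (simp_all add: scalar_conj_real_def power2_eq_square)
end

instantiation complex :: hilbert_scalar
begin
definition scalar_conj_complex :: "complex \<Rightarrow> complex" where "scalar_conj_complex = cnj"
instance
  by standard (simp_all add: scalar_conj_complex_def complex_norm_square [symmetric] scaleR_conv_of_real del: of_real_power)
end

definition scalar_ring :: "'k::hilbert_scalar ring" where
  "scalar_ring = \<lparr>carrier = UNIV, mult = (*), one = 1, zero = 0, add = (+)\<rparr>"


section \<open>Hilbert spaces\<close>

text \<open>
  Spaces are records with their own carrier and operations, so that in a family \<open>V i\<close> every
  member may be a different Hilbert space; the common type of the elements only bounds the
  cardinality. The ring multiplication and unit inherited from \<^term>\<open>module\<close> records are not used.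
\<close>

record ('k, 'a) inner_space = "('k, 'a) module" +
  inner_prod :: "'a \<Rightarrow> 'a \<Rightarrow> 'k"

definition hnorm :: "('k::hilbert_scalar, 'a) inner_space \<Rightarrow> 'a \<Rightarrow> real" where
  "hnorm X x = sqrt (norm (inner_prod X x x))"

text \<open>The value off the carrier is immaterial, but \<^locale>\<open>Metric_space\<close> requires a distance to be
  symmetric and nonnegative on the whole type.\<close>

definition hdist :: "('k::hilbert_scalar, 'a) inner_space \<Rightarrow> 'a \<Rightarrow> 'a \<Rightarrow> real" where
  "hdist X x y = (if x \<in> carrier X \<and> y \<in> carrier X then hnorm X (x \<ominus>\<^bsub>X\<^esub> y) else 0)"

text \<open>In \<open>inner_nonneg\<close> the inner product \<open>\<langle>x,x\<rangle>\<close> is said to be a nonnegative real.\<close>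

locale hilbert_space = Module.module scalar_ring X
  for X :: "('k::hilbert_scalar, 'a) inner_space" (structure) +
  assumes inner_add: "\<lbrakk>x \<in> carrier X; y \<in> carrier X; z \<in> carrier X\<rbrakk> \<Longrightarrow>
      inner_prod X (x \<oplus> y) z = inner_prod X x z + inner_prod X y z"
    and inner_smult: "\<lbrakk>x \<in> carrier X; y \<in> carrier X\<rbrakk> \<Longrightarrow>
      inner_prod X (c \<odot>\<^bsub>X\<^esub> x) y = c * inner_prod X x y"
    and inner_conj: "\<lbrakk>x \<in> carrier X; y \<in> carrier X\<rbrakk> \<Longrightarrow>
      inner_prod X y x = scalar_conj (inner_prod X x y)"
    and inner_nonneg: "x \<in> carrier X \<Longrightarrow>
      inner_prod X x x = of_real (norm (inner_prod X x x))"
    and inner_definite: "\<lbrakk>x \<in> carrier X; inner_prod X x x = 0\<rbrakk> \<Longrightarrow> x = \<zero>"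
    and complete: "Metric_space.mcomplete (carrier X) (hdist X)"

definition separable_hilbert_space :: "('k::hilbert_scalar, 'a) inner_space \<Rightarrow> bool" where
  "separable_hilbert_space X \<longleftrightarrow>
     hilbert_space X \<and> separable_space (Metric_space.mtopology (carrier X) (hdist X))"

definition hsum :: "('k::hilbert_scalar, 'a) inner_space \<Rightarrow> ('k, 'b) inner_space
    \<Rightarrow> ('k, 'a \<times> 'b) inner_space" (infixr \<open>\<oplus>\<^sub>H\<close> 65) where
  "H \<oplus>\<^sub>H K =
    \<lparr>carrier = carrier H \<times> carrier K,
     mult = undefined, one = undefined,
     zero = (\<zero>\<^bsub>H\<^esub>, \<zero>\<^bsub>K\<^esub>),
     add = (\<lambda>(f, g) (f', g'). (f \<oplus>\<^bsub>H\<^esub> f', g \<oplus>\<^bsub>K\<^esub> g')),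
     smult = (\<lambda>c (f, g). (c \<odot>\<^bsub>H\<^esub> f, c \<odot>\<^bsub>K\<^esub> g)),
     inner_prod = (\<lambda>(f, g) (f', g'). inner_prod H f f' + inner_prod K g g')\<rparr>"


section \<open>Bounded operators\<close>

text \<open>Operators are functions on the element types; only their values on the carrier matter.
  The direct sum of operators \<open>P\<close> and \<open>Q\<close> is \<^term>\<open>map_prod P Q\<close>.\<close>

definition bounded_ops :: "('k::hilbert_scalar, 'a) inner_space \<Rightarrow> ('k, 'b) inner_space
    \<Rightarrow> ('a \<Rightarrow> 'b) set" where
  "bounded_ops X Y = {P. P ` carrier X \<subseteq> carrier Y \<and>
     (\<forall>x\<in>carrier X. \<forall>y\<in>carrier X. P (x \<oplus>\<^bsub>X\<^esub> y) = P x \<oplus>\<^bsub>Y\<^esub> P y) \<and>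
     (\<forall>c. \<forall>x\<in>carrier X. P (c \<odot>\<^bsub>X\<^esub> x) = c \<odot>\<^bsub>Y\<^esub> P x) \<and>
     (\<exists>b. \<forall>x\<in>carrier X. hnorm Y (P x) \<le> b * hnorm X x)}"

definition GL :: "('k::hilbert_scalar, 'a) inner_space \<Rightarrow> ('a \<Rightarrow> 'a) set" where
  "GL X = {T \<in> bounded_ops X X.
     \<exists>S\<in>bounded_ops X X. \<forall>x\<in>carrier X. S (T x) = x \<and> T (S x) = x}"


section \<open>Controlled g-frames\<close>

text \<open>\<^term>\<open>infsum\<close> is \<open>0\<close> on divergent families, so convergence is a separate condition. For
  controlled g-frames it follows from the Bessel condition, as \<open>T x\<close> is again in the space.\<close>

definition g_bessel :: "('k::hilbert_scalar, 'a) inner_space \<Rightarrow> (int \<Rightarrow> ('k, 'b) inner_space)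
    \<Rightarrow> int set \<Rightarrow> (int \<Rightarrow> 'a \<Rightarrow> 'b) \<Rightarrow> bool" where
  "g_bessel X Y I \<Lambda> \<longleftrightarrow>
     (\<exists>D. \<forall>x\<in>carrier X. (\<lambda>i. (hnorm (Y i) (\<Lambda> i x))\<^sup>2) summable_on I \<and>
        (\<Sum>\<^sub>\<infinity>i\<in>I. (hnorm (Y i) (\<Lambda> i x))\<^sup>2) \<le> D * (hnorm X x)\<^sup>2)"

definition controlled_g_frame :: "('k::hilbert_scalar, 'a) inner_space
    \<Rightarrow> (int \<Rightarrow> ('k, 'b) inner_space) \<Rightarrow> int set \<Rightarrow> ('a \<Rightarrow> 'a) \<Rightarrow> (int \<Rightarrow> 'a \<Rightarrow> 'b)
    \<Rightarrow> real \<Rightarrow> real \<Rightarrow> bool" where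
  "controlled_g_frame X Y I T \<Lambda> A B \<longleftrightarrow>
     hilbert_space X \<and> (\<forall>i\<in>I. hilbert_space (Y i)) \<and>
     T \<in> GL X \<and> (\<forall>i\<in>I. \<Lambda> i \<in> bounded_ops X (Y i)) \<and>
     0 < A \<and> A \<le> B \<and>
     g_bessel X Y I \<Lambda> \<and>
     (\<forall>x\<in>carrier X.
        A * (hnorm X x)\<^sup>2 \<le> (\<Sum>\<^sub>\<infinity>i\<in>I. (hnorm (Y i) (\<Lambda> i (T x)))\<^sup>2) \<and>
        (\<Sum>\<^sub>\<infinity>i\<in>I. (hnorm (Y i) (\<Lambda> i (T x)))\<^sup>2) \<le> B * (hnorm X x)\<^sup>2)"

end

theory Submission
  imports Defs
begin

text \<open>
  Everything rests on the identity \<open>\<parallel>(f, g)\<parallel>\<^sup>2 = \<parallel>f\<parallel>\<^sup>2 + \<parallel>g\<parallel>\<^sup>2\<close> in a direct sum (\<open>hnorm_hsum\<close>).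
  Applied in every \<open>V i \<oplus>\<^sub>H W i\<close>, it splits the frame sum of the direct sum at \<open>(f, g)\<close> into the frame
  sum of \<open>\<Lambda>\<close> at \<open>f\<close> plus that of \<open>\<Gamma>\<close> at \<open>g\<close> (\<open>has_sum_hnorm_hsum\<close>). Applied in \<open>H \<oplus>\<^sub>H K\<close>, it turns
  the sum of the two frame inequalities into the required one, once each constant has been
  replaced by the smaller of the two lower or the larger of the two upper ones
  (\<open>min_max_weighted_sum\<close>). The Bessel condition comes out in the same way.

  The substantial part is that a direct sum of Hilbert spaces is a Hilbert space
  (\<open>hilbert_space_hsum\<close>), and there the point is completeness. By the same identity the distance
  of the direct sum is the Euclidean product of the two distances, and a product of complete metric
  spaces is complete. This uses that the norm distance of a Hilbert space is a metric, hence the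
  triangle inequality, which is derived from the Cauchy-Schwarz inequality uniformly for real and
  complex scalars.
\<close>

section \<open>The norm of a Hilbert space\<close>

lemma scalar_conj_0 [simp]: "scalar_conj (0::'k::hilbert_scalar) = 0"
  using scalar_conj_add[of 0 "0::'k"] by simp

text \<open>The axiom on \<open>x * scalar_conj x\<close> determines the conjugate of a nonzero \<open>x\<close> as
  \<open>(norm x)\<^sup>2 / x\<close>; real scalars are therefore fixed and norms are preserved.\<close>

lemma scalar_conj_of_real [simp]: "scalar_conj (of_real r :: 'k::hilbert_scalar) = of_real r"
proof (cases "r = 0")
  case False
  have "of_real r * scalar_conj (of_real r :: 'k) = of_real r * of_real r"
    using mult_scalar_conj[of "of_real r :: 'k"]
    by (simp add: power2_eq_square scaleR_conv_of_real flip: abs_mult)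
  with False show ?thesis by simp
qed simp

lemma norm_scalar_conj [simp]: "norm (scalar_conj x) = norm (x::'k::hilbert_scalar)"
proof (cases "x = 0")
  case False
  have "norm x * norm (scalar_conj x) = norm x * norm x"
    using arg_cong[OF mult_scalar_conj[of x], of norm]
    by (simp add: norm_mult power2_eq_square)
  with False show ?thesis by simp
qed simp

lemma scalar_ring_simps [simp]:
  "carrier scalar_ring = UNIV" "mult scalar_ring = (*)" "one scalar_ring = 1"
  "zero scalar_ring = 0" "add scalar_ring = (+)"
  by (simp_all add: scalar_ring_def)

lemma cring_scalar_ring: "cring (scalar_ring :: 'k::hilbert_scalar ring)"
proof (rule cringI)
  show "abelian_group (scalar_ring :: 'k ring)"
    by (rule abelian_groupI) (auto simp: algebra_simps intro: exI[of _ "- _"])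
  show "comm_monoid (scalar_ring :: 'k ring)"
    by (rule comm_monoidI) auto
qed (simp add: algebra_simps)

lemma a_inv_scalar_ring: "\<ominus>\<^bsub>scalar_ring\<^esub> x = - (x :: 'k::hilbert_scalar)"
proof -
  interpret cring "scalar_ring :: 'k ring" by (rule cring_scalar_ring)
  show ?thesis by (rule minus_equality) auto
qed

lemma hnorm_nonneg [simp]: "0 \<le> hnorm X x"
  by (simp add: hnorm_def)

lemma hnorm_power2: "(hnorm X x)\<^sup>2 = norm (inner_prod X x x)"
  by (simp add: hnorm_def)

context hilbert_space
begin

lemma inner_self: "x \<in> carrier X \<Longrightarrow> inner_prod X x x = of_real ((hnorm X x)\<^sup>2)"
  by (simp add: hnorm_power2 inner_nonneg[symmetric])

lemma inner_add_right:
  assumes "x \<in> carrier X" "y \<in> carrier X" "z \<in> carrier X"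
  shows "inner_prod X z (x \<oplus> y) = inner_prod X z x + inner_prod X z y"
proof -
  have "inner_prod X z (x \<oplus> y) = scalar_conj (inner_prod X (x \<oplus> y) z)"
    using assms by (intro inner_conj) auto
  also have "\<dots> = inner_prod X z x + inner_prod X z y"
    using assms inner_conj[of x z] inner_conj[of y z]
    by (simp add: inner_add scalar_conj_add)
  finally show ?thesis .
qed

lemma inner_smult_right:
  assumes "x \<in> carrier X" "z \<in> carrier X"
  shows "inner_prod X z (c \<odot>\<^bsub>X\<^esub> x) = scalar_conj c * inner_prod X z x"
proof -
  have "inner_prod X z (c \<odot>\<^bsub>X\<^esub> x) = scalar_conj (inner_prod X (c \<odot>\<^bsub>X\<^esub> x) z)"
    using assms by (intro inner_conj) auto
  also have "\<dots> = scalar_conj c * inner_prod X z x"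
    using assms inner_conj[of x z] by (simp add: inner_smult scalar_conj_mult)
  finally show ?thesis .
qed

lemma hnorm_zero [simp]: "hnorm X \<zero> = 0"
proof -
  have "inner_prod X (0 \<odot>\<^bsub>X\<^esub> \<zero>) \<zero> = 0"
    by (subst inner_smult) auto
  then show ?thesis by (simp add: hnorm_def)
qed

lemma hnorm_eq_0_iff: "x \<in> carrier X \<Longrightarrow> hnorm X x = 0 \<longleftrightarrow> x = \<zero>"
  using inner_definite[of x] hnorm_zero by (auto simp: hnorm_def)

lemma hnorm_smult: "x \<in> carrier X \<Longrightarrow> hnorm X (c \<odot>\<^bsub>X\<^esub> x) = norm c * hnorm X x"
  by (simp add: hnorm_def inner_smult inner_smult_right norm_mult real_sqrt_mult)

lemma hnorm_minus:
  assumes "x \<in> carrier X"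
  shows "hnorm X (\<ominus> x) = hnorm X x"
proof -
  have "\<ominus> x = (- 1) \<odot>\<^bsub>X\<^esub> x"
    using smult_l_minus[of 1 x] smult_one[of x] assms by (simp add: a_inv_scalar_ring)
  then show ?thesis using hnorm_smult[OF assms, of "- 1"] by simp
qed

text \<open>The vector \<open>z = \<parallel>y\<parallel>\<^sup>2 x - \<langle>x,y\<rangle> y\<close> is \<open>\<parallel>y\<parallel>\<^sup>2\<close> times the component of \<open>x\<close> orthogonal to \<open>y\<close>, and
  \<open>\<parallel>z\<parallel>\<^sup>2 = \<parallel>y\<parallel>\<^sup>2 (\<parallel>y\<parallel>\<^sup>2 \<parallel>x\<parallel>\<^sup>2 - |\<langle>x,y\<rangle>|\<^sup>2)\<close> is nonnegative. Not dividing by \<open>\<parallel>y\<parallel>\<^sup>2\<close> keeps the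
  computation polynomial in the scalars.\<close>

lemma Cauchy_Schwarz:
  assumes [simp]: "x \<in> carrier X" "y \<in> carrier X"
  shows "norm (inner_prod X x y) \<le> hnorm X x * hnorm X y"
proof (cases "y = \<zero>")
  case True
  have "inner_prod X x (0 \<odot>\<^bsub>X\<^esub> \<zero>) = 0"
    by (subst inner_smult_right) auto
  with True show ?thesis by simp
next
  case False
  define a where "a = (hnorm X x)\<^sup>2"
  define n where "n = (hnorm X y)\<^sup>2"
  define b where "b = inner_prod X x y"
  define z where "z = of_real n \<odot>\<^bsub>X\<^esub> x \<oplus> (- b) \<odot>\<^bsub>X\<^esub> y"
  have [simp]: "z \<in> carrier X" by (simp add: z_def)
  have "n > 0" using False hnorm_eq_0_iff[of y] by (simp add: n_def)
  have conj_neg: "scalar_conj (- b) = - scalar_conj b"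
    using scalar_conj_add[of b "- b"] by (simp add: eq_neg_iff_add_eq_0 add.commute)
  have "of_real ((hnorm X z)\<^sup>2) = inner_prod X z z" by (simp add: inner_self)
  also have "\<dots> = of_real n * (of_real n * of_real a) - of_real n * (b * scalar_conj b)"
  proof -
    have self: "inner_prod X x x = of_real a" "inner_prod X y y = of_real n"
      by (simp_all add: inner_self a_def n_def)
    have cross: "inner_prod X x y = b" "inner_prod X y x = scalar_conj b"
      unfolding b_def by (simp_all flip: inner_conj)
    show ?thesis unfolding z_def
      by (simp add: inner_add inner_add_right inner_smult inner_smult_right conj_neg self cross
          algebra_simps)
  qed
  also have "\<dots> = of_real (n * (n * a - (norm b)\<^sup>2))"
    by (simp add: mult_scalar_conj scaleR_conv_of_real right_diff_distrib)
  finally have "n * (n * a - (norm b)\<^sup>2) = (hnorm X z)\<^sup>2"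
    by (simp only: of_real_eq_iff)
  then have "0 \<le> n * (n * a - (norm b)\<^sup>2)" by (simp only: zero_le_power2)
  with \<open>n > 0\<close> have "(norm b)\<^sup>2 \<le> n * a"
    by (simp add: zero_le_mult_iff)
  also have "\<dots> = (hnorm X x * hnorm X y)\<^sup>2" by (simp add: n_def a_def power_mult_distrib)
  finally show ?thesis
    unfolding b_def by (rule power2_le_imp_le) simp
qed

text \<open>Bounding both cross terms of \<open>\<parallel>x + y\<parallel>\<^sup>2\<close> in absolute value avoids real parts, which a
  general scalar field does not provide.\<close>

lemma hnorm_triangle:
  assumes [simp]: "x \<in> carrier X" "y \<in> carrier X"
  shows "hnorm X (x \<oplus> y) \<le> hnorm X x + hnorm X y"
proof (rule power2_le_imp_le)
  have "(hnorm X (x \<oplus> y))\<^sup>2 =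
      norm (inner_prod X x x + inner_prod X x y + (inner_prod X y x + inner_prod X y y))"
    by (simp add: hnorm_power2 inner_add inner_add_right algebra_simps)
  also have "\<dots> \<le> norm (inner_prod X x x) + norm (inner_prod X x y)
      + (norm (inner_prod X y x) + norm (inner_prod X y y))"
    by (rule order_trans[OF norm_triangle_ineq add_mono[OF norm_triangle_ineq norm_triangle_ineq]])
  also have "\<dots> \<le> (hnorm X x)\<^sup>2 + hnorm X x * hnorm X y
      + (hnorm X y * hnorm X x + (hnorm X y)\<^sup>2)"
    using Cauchy_Schwarz[of x y] Cauchy_Schwarz[of y x]
    by (intro add_mono) (simp_all add: hnorm_power2)
  also have "\<dots> = (hnorm X x + hnorm X y)\<^sup>2"
    by (simp add: power2_eq_square algebra_simps)
  finally show "(hnorm X (x \<oplus> y))\<^sup>2 \<le> (hnorm X x + hnorm X y)\<^sup>2" .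
qed simp

lemma Metric_space_hdist: "Metric_space (carrier X) (hdist X)"
proof
  fix x y
  show "0 \<le> hdist X x y" by (simp add: hdist_def)
  show "hdist X x y = hdist X y x"
  proof (cases "x \<in> carrier X \<and> y \<in> carrier X")
    case True
    then have "\<ominus> (y \<ominus> x) = x \<ominus> y"
      using a_comm[of "\<ominus> y" x] by (simp add: a_minus_def minus_add)
    then have "hnorm X (x \<ominus> y) = hnorm X (y \<ominus> x)"
      using True hnorm_minus[of "y \<ominus> x"] by simp
    with True show ?thesis by (simp add: hdist_def)
  qed (auto simp: hdist_def)
next
  fix x y assume xy: "x \<in> carrier X" "y \<in> carrier X"
  have "x \<ominus> y = \<zero> \<longleftrightarrow> x = y"
  proof
    assume "x \<ominus> y = \<zero>"
    then have "\<ominus> (\<ominus> y) = x"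
      using xy by (intro minus_equality) (simp_all add: a_minus_def)
    with xy show "x = y" by simp
  qed (use xy in \<open>simp add: a_minus_def r_neg\<close>)
  then show "hdist X x y = 0 \<longleftrightarrow> x = y"
    using xy by (simp add: hdist_def hnorm_eq_0_iff)
next
  fix x y z assume xyz [simp]: "x \<in> carrier X" "y \<in> carrier X" "z \<in> carrier X"
  have "x \<ominus> z = (x \<ominus> y) \<oplus> (y \<ominus> z)"
    using a_assoc[of x "\<ominus> y" "y \<oplus> \<ominus> z"] r_neg1[of y "\<ominus> z"] by (simp add: a_minus_def)
  then have "hnorm X (x \<ominus> z) \<le> hnorm X (x \<ominus> y) + hnorm X (y \<ominus> z)"
    using hnorm_triangle[of "x \<ominus> y" "y \<ominus> z"] xyz by (simp only: minus_closed)
  then show "hdist X x z \<le> hdist X x y + hdist X y z"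
    by (simp add: hdist_def)
qed

end

section \<open>Direct sums of Hilbert spaces\<close>

text \<open>The product metric \<^const>\<open>prod_dist\<close> of two distances and the distance of the direct sum agree on
  the product of the carriers but not outside it, where the latter is \<open>0\<close>. Metric notions see only
  the carrier, so completeness passes from one to the other.\<close>

lemma Metric_space_restrict:
  assumes "Metric_space M d"
  shows "Metric_space M (\<lambda>x y. if x \<in> M \<and> y \<in> M then d x y else 0)"
proof -
  interpret Metric_space M d by fact
  show ?thesis
  proof
    fix x y z assume "x \<in> M" "y \<in> M" "z \<in> M"
    then show "(if x \<in> M \<and> z \<in> M then d x z else 0)
        \<le> (if x \<in> M \<and> y \<in> M then d x y else 0) + (if y \<in> M \<and> z \<in> M then d y z else 0)"
      using triangle by simp
  qed (simp_all add: commute)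
qed

lemma mcomplete_restrict:
  assumes "Metric_space M d" and "Metric_space.mcomplete M d"
  shows "Metric_space.mcomplete M (\<lambda>x y. if x \<in> M \<and> y \<in> M then d x y else 0)"
proof -
  interpret d: Metric_space M d by fact
  interpret r: Metric_space M "\<lambda>x y. if x \<in> M \<and> y \<in> M then d x y else 0"
    by (rule Metric_space_restrict) fact
  have cauchy: "r.MCauchy \<sigma> \<longleftrightarrow> d.MCauchy \<sigma>" for \<sigma>
  proof (cases "range \<sigma> \<subseteq> M")
    case True
    then have "\<sigma> n \<in> M" for n by blast
    then show ?thesis by (simp add: r.MCauchy_def d.MCauchy_def)
  qed (simp add: r.MCauchy_def d.MCauchy_def)
  have "limitin r.mtopology \<sigma> l F \<longleftrightarrow> limitin d.mtopology \<sigma> l F" for \<sigma> l and F :: "nat filter"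
    unfolding r.limitin_metric d.limitin_metric by (simp cong: conj_cong)
  with assms(2) cauchy show ?thesis by (simp add: r.mcomplete_def d.mcomplete_def)
qed

lemma hsum_simps [simp]:
  "carrier (H \<oplus>\<^sub>H K) = carrier H \<times> carrier K"
  "\<zero>\<^bsub>H \<oplus>\<^sub>H K\<^esub> = (\<zero>\<^bsub>H\<^esub>, \<zero>\<^bsub>K\<^esub>)"
  "(f, g) \<oplus>\<^bsub>H \<oplus>\<^sub>H K\<^esub> (f', g') = (f \<oplus>\<^bsub>H\<^esub> f', g \<oplus>\<^bsub>K\<^esub> g')"
  "c \<odot>\<^bsub>H \<oplus>\<^sub>H K\<^esub> (f, g) = (c \<odot>\<^bsub>H\<^esub> f, c \<odot>\<^bsub>K\<^esub> g)"
  "inner_prod (H \<oplus>\<^sub>H K) (f, g) (f', g') = inner_prod H f f' + inner_prod K g g'"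
  by (simp_all add: hsum_def)

locale hilbert_space_pair = H: hilbert_space H + K: hilbert_space K
  for H :: "('k::hilbert_scalar, 'h) inner_space" and K :: "('k, 'l) inner_space"
begin

lemma module_hsum: "Module.module scalar_ring (H \<oplus>\<^sub>H K)"
proof (rule moduleI)
  show "abelian_group (H \<oplus>\<^sub>H K)"
  proof (rule abelian_groupI)
    fix x assume "x \<in> carrier (H \<oplus>\<^sub>H K)"
    then show "\<exists>y\<in>carrier (H \<oplus>\<^sub>H K). y \<oplus>\<^bsub>H \<oplus>\<^sub>H K\<^esub> x = \<zero>\<^bsub>H \<oplus>\<^sub>H K\<^esub>"
      by (intro bexI[of _ "(\<ominus>\<^bsub>H\<^esub> fst x, \<ominus>\<^bsub>K\<^esub> snd x)"]) (auto simp: H.l_neg K.l_neg)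
  qed (auto simp: H.a_assoc K.a_assoc intro: H.a_comm K.a_comm)
qed (auto simp: cring_scalar_ring H.smult_r_distr K.smult_r_distr
    H.smult_l_distr[simplified] K.smult_l_distr[simplified]
    H.smult_assoc1[simplified] K.smult_assoc1[simplified]
    H.smult_one[simplified] K.smult_one[simplified])

text \<open>Two nonnegative reals add up without cancellation, so the direct sum inherits positivity from
  its summands; this is also what gives the norm identity below.\<close>

lemma inner_hsum_self:
  assumes "f \<in> carrier H" "g \<in> carrier K"
  shows "inner_prod (H \<oplus>\<^sub>H K) (f, g) (f, g) = of_real ((hnorm H f)\<^sup>2 + (hnorm K g)\<^sup>2)"
  using assms by (simp add: H.inner_self K.inner_self)

lemma hnorm_hsum:
  assumes "f \<in> carrier H" "g \<in> carrier K"
  shows "(hnorm (H \<oplus>\<^sub>H K) (f, g))\<^sup>2 = (hnorm H f)\<^sup>2 + (hnorm K g)\<^sup>2"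
  unfolding hnorm_power2[of "H \<oplus>\<^sub>H K"] inner_hsum_self[OF assms] norm_of_real by simp

lemma minus_hsum:
  assumes "f \<in> carrier H" "g \<in> carrier K" "f' \<in> carrier H" "g' \<in> carrier K"
  shows "(f, g) \<ominus>\<^bsub>H \<oplus>\<^sub>H K\<^esub> (f', g') = (f \<ominus>\<^bsub>H\<^esub> f', g \<ominus>\<^bsub>K\<^esub> g')"
proof -
  interpret S: Module.module scalar_ring "H \<oplus>\<^sub>H K" by (rule module_hsum)
  have "\<ominus>\<^bsub>H \<oplus>\<^sub>H K\<^esub> (f', g') = (\<ominus>\<^bsub>H\<^esub> f', \<ominus>\<^bsub>K\<^esub> g')"
    using assms by (intro S.minus_equality) (auto simp: H.l_neg K.l_neg)
  then show ?thesis by (simp add: a_minus_def)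
qed

lemma hdist_hsum:
  "hdist (H \<oplus>\<^sub>H K) = (\<lambda>p q. if p \<in> carrier H \<times> carrier K \<and> q \<in> carrier H \<times> carrier K
     then prod_dist (hdist H) (hdist K) p q else 0)"
proof (intro ext)
  fix p q :: "'h \<times> 'l"
  obtain f g f' g' where pq: "p = (f, g)" "q = (f', g')" by fastforce
  show "hdist (H \<oplus>\<^sub>H K) p q = (if p \<in> carrier H \<times> carrier K \<and> q \<in> carrier H \<times> carrier K
     then prod_dist (hdist H) (hdist K) p q else 0)"
    using hnorm_hsum[of "f \<ominus>\<^bsub>H\<^esub> f'" "g \<ominus>\<^bsub>K\<^esub> g'"]
    by (auto simp: pq hdist_def prod_dist_def minus_hsum real_sqrt_unique)
qed

lemma mcomplete_hsum:
  "Metric_space.mcomplete (carrier (H \<oplus>\<^sub>H K)) (hdist (H \<oplus>\<^sub>H K))"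
proof -
  interpret D: Metric_space12 "carrier H" "hdist H" "carrier K" "hdist K"
    by (intro Metric_space12.intro H.Metric_space_hdist K.Metric_space_hdist)
  have "D.Prod_metric.mcomplete"
    using H.complete K.complete by (simp add: D.mcomplete_prod_metric)
  then show ?thesis
    unfolding hdist_hsum hsum_simps by (intro mcomplete_restrict D.prod_metric)
qed

lemma hilbert_space_hsum: "hilbert_space (H \<oplus>\<^sub>H K)"
proof (intro hilbert_space.intro hilbert_space_axioms.intro module_hsum mcomplete_hsum)
  fix x assume x: "x \<in> carrier (H \<oplus>\<^sub>H K)"
  then obtain f g where fg: "x = (f, g)" "f \<in> carrier H" "g \<in> carrier K" by auto
  show "inner_prod (H \<oplus>\<^sub>H K) x x = of_real (norm (inner_prod (H \<oplus>\<^sub>H K) x x))"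
    unfolding fg(1) inner_hsum_self[OF fg(2,3)] norm_of_real by simp
  assume "inner_prod (H \<oplus>\<^sub>H K) x x = 0"
  then have "(hnorm H f)\<^sup>2 + (hnorm K g)\<^sup>2 = 0"
    unfolding fg(1) inner_hsum_self[OF fg(2,3)] of_real_eq_0_iff .
  then show "x = \<zero>\<^bsub>H \<oplus>\<^sub>H K\<^esub>"
    using fg by (simp add: sum_power2_eq_zero_iff H.hnorm_eq_0_iff K.hnorm_eq_0_iff)
next
  fix x y assume "x \<in> carrier (H \<oplus>\<^sub>H K)" "y \<in> carrier (H \<oplus>\<^sub>H K)"
  then obtain f g f' g' where xy: "x = (f, g)" "y = (f', g')"
    and c: "f \<in> carrier H" "g \<in> carrier K" "f' \<in> carrier H" "g' \<in> carrier K"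
    by auto
  show "inner_prod (H \<oplus>\<^sub>H K) y x = scalar_conj (inner_prod (H \<oplus>\<^sub>H K) x y)"
    unfolding xy using H.inner_conj[of f f'] K.inner_conj[of g g'] c
    by (simp add: scalar_conj_add)
  fix c
  show "inner_prod (H \<oplus>\<^sub>H K) (c \<odot>\<^bsub>H \<oplus>\<^sub>H K\<^esub> x) y = c * inner_prod (H \<oplus>\<^sub>H K) x y"
    unfolding xy using c by (simp add: H.inner_smult K.inner_smult distrib_left)
qed (auto simp: H.inner_add K.inner_add)

end

section \<open>Direct sums of operators\<close>

lemma bounded_ops_closed: "P \<in> bounded_ops X Y \<Longrightarrow> x \<in> carrier X \<Longrightarrow> P x \<in> carrier Y"
  by (auto simp: bounded_ops_def)

text \<open>Squaring makes the bounds of two operators additive over a direct sum, and writing the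
  squared constant as \<open>b\<^sup>2\<close> spares its sign, which the definition leaves open.\<close>

lemma bounded_ops_square_bound:
  assumes "P \<in> bounded_ops X Y"
  shows "\<exists>b. \<forall>x\<in>carrier X. (hnorm Y (P x))\<^sup>2 \<le> b\<^sup>2 * (hnorm X x)\<^sup>2"
proof -
  from assms obtain b where b: "\<forall>x\<in>carrier X. hnorm Y (P x) \<le> b * hnorm X x"
    by (auto simp: bounded_ops_def)
  have "(hnorm Y (P x))\<^sup>2 \<le> b\<^sup>2 * (hnorm X x)\<^sup>2" if "x \<in> carrier X" for x
    using b that power_mono[of "hnorm Y (P x)" "b * hnorm X x" 2]
    by (simp add: power_mult_distrib)
  then show ?thesis by blast
qed

lemma map_prod_bounded_ops:
  fixes H :: "('k::hilbert_scalar, 'h) inner_space" and K :: "('k, 'l) inner_space"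
    and V :: "('k, 'v) inner_space" and W :: "('k, 'w) inner_space"
  assumes "hilbert_space H" "hilbert_space K" "hilbert_space V" "hilbert_space W"
    and P: "P \<in> bounded_ops H V" and Q: "Q \<in> bounded_ops K W"
  shows "map_prod P Q \<in> bounded_ops (H \<oplus>\<^sub>H K) (V \<oplus>\<^sub>H W)"
proof -
  interpret HK: hilbert_space_pair H K by (intro hilbert_space_pair.intro assms)
  interpret VW: hilbert_space_pair V W by (intro hilbert_space_pair.intro assms)
  obtain b where b: "\<forall>f\<in>carrier H. (hnorm V (P f))\<^sup>2 \<le> b\<^sup>2 * (hnorm H f)\<^sup>2"
    using bounded_ops_square_bound[OF P] by blast
  obtain c where c: "\<forall>g\<in>carrier K. (hnorm W (Q g))\<^sup>2 \<le> c\<^sup>2 * (hnorm K g)\<^sup>2"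
    using bounded_ops_square_bound[OF Q] by blast
  have bound: "hnorm (V \<oplus>\<^sub>H W) (P f, Q g) \<le> sqrt (b\<^sup>2 + c\<^sup>2) * hnorm (H \<oplus>\<^sub>H K) (f, g)"
    if fg: "f \<in> carrier H" "g \<in> carrier K" for f g
  proof (rule power2_le_imp_le)
    have "(hnorm (V \<oplus>\<^sub>H W) (P f, Q g))\<^sup>2 = (hnorm V (P f))\<^sup>2 + (hnorm W (Q g))\<^sup>2"
      using fg P Q by (simp add: VW.hnorm_hsum bounded_ops_closed)
    also have "\<dots> \<le> b\<^sup>2 * (hnorm H f)\<^sup>2 + c\<^sup>2 * (hnorm K g)\<^sup>2"
      using fg b c by (intro add_mono) auto
    also have "\<dots> \<le> (b\<^sup>2 + c\<^sup>2) * ((hnorm H f)\<^sup>2 + (hnorm K g)\<^sup>2)"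
      by (simp add: algebra_simps)
    also have "\<dots> = (sqrt (b\<^sup>2 + c\<^sup>2) * hnorm (H \<oplus>\<^sub>H K) (f, g))\<^sup>2"
      using fg by (simp add: HK.hnorm_hsum power_mult_distrib)
    finally show "(hnorm (V \<oplus>\<^sub>H W) (P f, Q g))\<^sup>2 \<le>
      (sqrt (b\<^sup>2 + c\<^sup>2) * hnorm (H \<oplus>\<^sub>H K) (f, g))\<^sup>2" .
  qed simp
  show ?thesis
    unfolding bounded_ops_def
  proof (intro CollectI conjI)
    show "\<exists>b. \<forall>x\<in>carrier (H \<oplus>\<^sub>H K). hnorm (V \<oplus>\<^sub>H W) (map_prod P Q x) \<le> b * hnorm (H \<oplus>\<^sub>H K) x"
      using bound by (intro exI[of _ "sqrt (b\<^sup>2 + c\<^sup>2)"]) auto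
  qed (use P Q in \<open>auto simp: bounded_ops_def\<close>)
qed

lemma map_prod_GL:
  fixes H :: "('k::hilbert_scalar, 'h) inner_space" and K :: "('k, 'l) inner_space"
  assumes "hilbert_space H" "hilbert_space K" and T: "T \<in> GL H" and U: "U \<in> GL K"
  shows "map_prod T U \<in> GL (H \<oplus>\<^sub>H K)"
proof -
  obtain S where S: "S \<in> bounded_ops H H" "\<forall>x\<in>carrier H. S (T x) = x \<and> T (S x) = x"
    using T by (auto simp: GL_def)
  obtain R where R: "R \<in> bounded_ops K K" "\<forall>x\<in>carrier K. R (U x) = x \<and> U (R x) = x"
    using U by (auto simp: GL_def)
  have "map_prod T U \<in> bounded_ops (H \<oplus>\<^sub>H K) (H \<oplus>\<^sub>H K)"
    using T U assms by (intro map_prod_bounded_ops) (auto simp: GL_def)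
  moreover have "map_prod S R \<in> bounded_ops (H \<oplus>\<^sub>H K) (H \<oplus>\<^sub>H K)"
    using S R assms by (intro map_prod_bounded_ops) auto
  ultimately show ?thesis
    unfolding GL_def using S R by (auto intro!: bexI[of _ "map_prod S R"])
qed

section \<open>Direct sums of controlled g-frames\<close>

text \<open>Each term of the left-hand series is a sum of two squares, so the two given series can be
  added. Summability of both is needed because \<^const>\<open>infsum\<close> is \<open>0\<close> on divergent families.\<close>

lemma has_sum_hnorm_hsum:
  fixes V :: "int \<Rightarrow> ('k::hilbert_scalar, 'v) inner_space" and W :: "int \<Rightarrow> ('k, 'w) inner_space"
  assumes VW: "\<And>i. i \<in> I \<Longrightarrow> hilbert_space (V i)" "\<And>i. i \<in> I \<Longrightarrow> hilbert_space (W i)"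
    and v: "\<And>i. i \<in> I \<Longrightarrow> v i \<in> carrier (V i)" and w: "\<And>i. i \<in> I \<Longrightarrow> w i \<in> carrier (W i)"
    and sums: "(\<lambda>i. (hnorm (V i) (v i))\<^sup>2) summable_on I" "(\<lambda>i. (hnorm (W i) (w i))\<^sup>2) summable_on I"
  shows "((\<lambda>i. (hnorm (V i \<oplus>\<^sub>H W i) (v i, w i))\<^sup>2) has_sum
     ((\<Sum>\<^sub>\<infinity>i\<in>I. (hnorm (V i) (v i))\<^sup>2) + (\<Sum>\<^sub>\<infinity>i\<in>I. (hnorm (W i) (w i))\<^sup>2))) I"
proof -
  have "(hnorm (V i \<oplus>\<^sub>H W i) (v i, w i))\<^sup>2 = (hnorm (V i) (v i))\<^sup>2 + (hnorm (W i) (w i))\<^sup>2"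
    if "i \<in> I" for i
    using that by (intro hilbert_space_pair.hnorm_hsum hilbert_space_pair.intro VW v w)
  then show ?thesis
    using sums by (subst has_sum_cong) (auto intro!: has_sum_add has_sum_infsum)
qed

lemma min_max_weighted_sum:
  fixes A B C D a b s t :: real
  assumes "0 \<le> a" "0 \<le> b" "A * a \<le> s" "s \<le> B * a" "C * b \<le> t" "t \<le> D * b"
  shows "min A C * (a + b) \<le> s + t" "s + t \<le> max B D * (a + b)"
proof -
  have "min A C * a \<le> A * a" "min A C * b \<le> C * b" "B * a \<le> max B D * a" "D * b \<le> max B D * b"
    using assms(1,2) by (auto intro: mult_right_mono)
  with assms show "min A C * (a + b) \<le> s + t" "s + t \<le> max B D * (a + b)"
    by (auto simp: distrib_left)
qed

theorem theorem2p9: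
  fixes H :: "('k::hilbert_scalar, 'h) inner_space"
    and K :: "('k, 'l) inner_space"
    and I :: "int set"
    and V :: "int \<Rightarrow> ('k, 'v) inner_space"
    and W :: "int \<Rightarrow> ('k, 'w) inner_space"
    and T :: "'h \<Rightarrow> 'h" and U :: "'l \<Rightarrow> 'l"
    and \<Lambda> :: "int \<Rightarrow> 'h \<Rightarrow> 'v" and \<Gamma> :: "int \<Rightarrow> 'l \<Rightarrow> 'w"
    and A B C D :: real
  assumes "separable_hilbert_space H" and "separable_hilbert_space K"
    and "\<And>i. i \<in> I \<Longrightarrow> hilbert_space (V i)" and "\<And>i. i \<in> I \<Longrightarrow> hilbert_space (W i)"
    and "T \<in> GL H" and "U \<in> GL K"
    and "\<And>i. i \<in> I \<Longrightarrow> \<Lambda> i \<in> bounded_ops H (V i)"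
    and "\<And>i. i \<in> I \<Longrightarrow> \<Gamma> i \<in> bounded_ops K (W i)"
    and "controlled_g_frame H V I T \<Lambda> A B"
    and "controlled_g_frame K W I U \<Gamma> C D"
  shows "controlled_g_frame (H \<oplus>\<^sub>H K) (\<lambda>i. V i \<oplus>\<^sub>H W i) I (map_prod T U)
           (\<lambda>i. map_prod (\<Lambda> i) (\<Gamma> i)) (min A C) (max B D) \<and>
         (\<forall>f\<in>carrier H. \<forall>g\<in>carrier K.
            (\<lambda>i. (hnorm (V i \<oplus>\<^sub>H W i) (map_prod (\<Lambda> i) (\<Gamma> i) (T f, U g)))\<^sup>2) summable_on I \<and>
            min A C * (hnorm (H \<oplus>\<^sub>H K) (f, g))\<^sup>2
              \<le> (\<Sum>\<^sub>\<infinity>i\<in>I. (hnorm (V i \<oplus>\<^sub>H W i) (map_prod (\<Lambda> i) (\<Gamma> i) (T f, U g)))\<^sup>2) \<and>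
            (\<Sum>\<^sub>\<infinity>i\<in>I. (hnorm (V i \<oplus>\<^sub>H W i) (map_prod (\<Lambda> i) (\<Gamma> i) (T f, U g)))\<^sup>2)
              \<le> max B D * (hnorm (H \<oplus>\<^sub>H K) (f, g))\<^sup>2)"
proof -
  have H: "hilbert_space H" and K: "hilbert_space K"
    using assms(1,2) by (auto simp: separable_hilbert_space_def)
  interpret HK: hilbert_space_pair H K by (intro hilbert_space_pair.intro H K)
  have TU: "T f \<in> carrier H" "U g \<in> carrier K" if "f \<in> carrier H" "g \<in> carrier K" for f g
    using that assms(5,6) by (auto simp: GL_def dest: bounded_ops_closed)
  obtain D1 where D1: "\<forall>f\<in>carrier H. (\<lambda>i. (hnorm (V i) (\<Lambda> i f))\<^sup>2) summable_on I \<and>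
      (\<Sum>\<^sub>\<infinity>i\<in>I. (hnorm (V i) (\<Lambda> i f))\<^sup>2) \<le> D1 * (hnorm H f)\<^sup>2"
    using assms(9) unfolding controlled_g_frame_def g_bessel_def by blast
  obtain D2 where D2: "\<forall>g\<in>carrier K. (\<lambda>i. (hnorm (W i) (\<Gamma> i g))\<^sup>2) summable_on I \<and>
      (\<Sum>\<^sub>\<infinity>i\<in>I. (hnorm (W i) (\<Gamma> i g))\<^sup>2) \<le> D2 * (hnorm K g)\<^sup>2"
    using assms(10) unfolding controlled_g_frame_def g_bessel_def by blast
  have sum: "((\<lambda>i. (hnorm (V i \<oplus>\<^sub>H W i) (\<Lambda> i f, \<Gamma> i g))\<^sup>2) has_sum
      ((\<Sum>\<^sub>\<infinity>i\<in>I. (hnorm (V i) (\<Lambda> i f))\<^sup>2) + (\<Sum>\<^sub>\<infinity>i\<in>I. (hnorm (W i) (\<Gamma> i g))\<^sup>2))) I"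
    if "f \<in> carrier H" "g \<in> carrier K" for f g
    using that D1 D2 assms(3,4) bounded_ops_closed[OF assms(7)] bounded_ops_closed[OF assms(8)]
    by (intro has_sum_hnorm_hsum) auto
  \<comment> \<open>A Bessel sum has the trivial lower bound 0, so it is an instance of the two-sided estimate.\<close>
  have bessel: "g_bessel (H \<oplus>\<^sub>H K) (\<lambda>i. V i \<oplus>\<^sub>H W i) I (\<lambda>i. map_prod (\<Lambda> i) (\<Gamma> i))"
    unfolding g_bessel_def
  proof (intro exI ballI)
    fix x assume "x \<in> carrier (H \<oplus>\<^sub>H K)"
    then obtain f g where x: "x = (f, g)" and fg: "f \<in> carrier H" "g \<in> carrier K" by auto
    let ?s = "\<Sum>\<^sub>\<infinity>i\<in>I. (hnorm (V i) (\<Lambda> i f))\<^sup>2" and ?t = "\<Sum>\<^sub>\<infinity>i\<in>I. (hnorm (W i) (\<Gamma> i g))\<^sup>2"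
    have "0 \<le> ?s" "0 \<le> ?t" by (auto intro: infsum_nonneg)
    then have "?s + ?t \<le> max D1 D2 * ((hnorm H f)\<^sup>2 + (hnorm K g)\<^sup>2)"
      using D1 D2 fg
      by (intro min_max_weighted_sum(2)[where A = 0 and C = 0]) auto
    then show "(\<lambda>i. (hnorm (V i \<oplus>\<^sub>H W i) (map_prod (\<Lambda> i) (\<Gamma> i) x))\<^sup>2) summable_on I \<and>
        (\<Sum>\<^sub>\<infinity>i\<in>I. (hnorm (V i \<oplus>\<^sub>H W i) (map_prod (\<Lambda> i) (\<Gamma> i) x))\<^sup>2)
          \<le> max D1 D2 * (hnorm (H \<oplus>\<^sub>H K) x)\<^sup>2"
      using sum[OF fg] fg
      by (auto simp: x HK.hnorm_hsum infsumI intro: has_sum_imp_summable)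
  qed
  have frame: "(\<lambda>i. (hnorm (V i \<oplus>\<^sub>H W i) (map_prod (\<Lambda> i) (\<Gamma> i) (T f, U g)))\<^sup>2) summable_on I \<and>
      min A C * (hnorm (H \<oplus>\<^sub>H K) (f, g))\<^sup>2
        \<le> (\<Sum>\<^sub>\<infinity>i\<in>I. (hnorm (V i \<oplus>\<^sub>H W i) (map_prod (\<Lambda> i) (\<Gamma> i) (T f, U g)))\<^sup>2) \<and>
      (\<Sum>\<^sub>\<infinity>i\<in>I. (hnorm (V i \<oplus>\<^sub>H W i) (map_prod (\<Lambda> i) (\<Gamma> i) (T f, U g)))\<^sup>2)
        \<le> max B D * (hnorm (H \<oplus>\<^sub>H K) (f, g))\<^sup>2"
    if fg: "f \<in> carrier H" "g \<in> carrier K" for f g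
  proof -
    let ?s = "\<Sum>\<^sub>\<infinity>i\<in>I. (hnorm (V i) (\<Lambda> i (T f)))\<^sup>2" and ?t = "\<Sum>\<^sub>\<infinity>i\<in>I. (hnorm (W i) (\<Gamma> i (U g)))\<^sup>2"
    have "A * (hnorm H f)\<^sup>2 \<le> ?s" "?s \<le> B * (hnorm H f)\<^sup>2"
      "C * (hnorm K g)\<^sup>2 \<le> ?t" "?t \<le> D * (hnorm K g)\<^sup>2"
      using assms(9,10) fg by (auto simp: controlled_g_frame_def)
    then have "min A C * ((hnorm H f)\<^sup>2 + (hnorm K g)\<^sup>2) \<le> ?s + ?t"
      "?s + ?t \<le> max B D * ((hnorm H f)\<^sup>2 + (hnorm K g)\<^sup>2)"
      by (intro min_max_weighted_sum; simp)+
    with sum[OF TU[OF fg]] fg show ?thesis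
      by (auto simp: HK.hnorm_hsum infsumI intro: has_sum_imp_summable)
  qed
  have "controlled_g_frame (H \<oplus>\<^sub>H K) (\<lambda>i. V i \<oplus>\<^sub>H W i) I (map_prod T U)
      (\<lambda>i. map_prod (\<Lambda> i) (\<Gamma> i)) (min A C) (max B D)"
    unfolding controlled_g_frame_def
  proof (intro conjI ballI bessel HK.hilbert_space_hsum)
    show "map_prod T U \<in> GL (H \<oplus>\<^sub>H K)"
      by (intro map_prod_GL H K assms)
    show "0 < min A C" "min A C \<le> max B D"
      using assms(9,10) by (auto simp: controlled_g_frame_def)
  next
    fix i assume i: "i \<in> I"
    show "hilbert_space (V i \<oplus>\<^sub>H W i)"
      using i assms(3,4) by (intro hilbert_space_pair.hilbert_space_hsum hilbert_space_pair.intro)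
    show "map_prod (\<Lambda> i) (\<Gamma> i) \<in> bounded_ops (H \<oplus>\<^sub>H K) (V i \<oplus>\<^sub>H W i)"
      using i by (intro map_prod_bounded_ops H K assms)
  qed (use frame in auto)
  with frame show ?thesis by blast
qed

end
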